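(* Let $(a_1,a_2,\ldots,a_k)$, a composition of $n$ with positive entries, be the reduced content of a Fubini ranking. Then the number of weakly flattened Fubini rankings with runs of ascents having reduced content $(a_1,a_2,\ldots,a_k)$ is $$\sum_{j_2=0}^{a_2}\left(\binom{a_1-1}{a_2-j_2}\sum_{j_3=0}^{a_3}\left(\binom{a_1+j_2-1}{a_3-j_3}\sum_{j_4=0}^{a_4}\left(\cdots\sum_{j_k=0}^{a_k}\left(\binom{a_1+j_2+j_3+\cdots+j_{k-1}-1}{a_k-j_k}\right)\cdots\right)\right)\right),$$ that is, the sum over all integer tuples $(j_2,\ldots,j_k)$ with $0\le j_i\le a_i$ of $\prod_{i=2}^{k}\binom{a_1+\sum_{r=2}^{i-1}j_r-1}{a_i-j_i}$.
   Context: Let $[n]=\{1,2,\ldots,n\}$. A Fubini ranking of length $n$ is a tuple $r=(r_1,\ldots,r_n)\in[n]^n$ that records a valid ranking of $n$ competitors with ties allowed, where if exactly $k$ competitors are tied at rank $i$, then the next $k-1$ ranks $i+1,\ldots,i+k-1$ are disallowed; equivalently, $r_i=1+|\{j : r_j<r_i\}|$ for every $i\in[n]$. The content of a Fubini ranking of length $n$ is the tuple $(c_1,\ldots,c_n)$ where $c_i$ is the number of entries equal to $i$; the reduced content is obtained from the content by deleting all entries equal to $0$. A run of ascents of a word $w=w_1\cdots w_n$ is a maximal contiguous subword $w_iw_{i+1}\cdots w_j$ with $w_l<w_{l+1}$ for all $i\le l\le j-1$. A Fubini ranking is weakly flattened with runs of ascents if the leading (first) terms of its runs of ascents, read from left to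 right, are in weakly increasing order. An empty nested sum (case $k=1$) is read as $1$. *)

theory Defs
  imports Main "HOL-Library.FuncSet"
begin

text \<open>
  Tuples and words are lists. List positions count from 0, whereas the ranks, i.e. the
  entries of a ranking, count from 1.
\<close>

definition fubini_ranking :: "nat \<Rightarrow> nat list \<Rightarrow> bool" where
  "fubini_ranking n r \<longleftrightarrow>
     length r = n \<and> set r \<subseteq> {1..n} \<and>
     (\<forall>i<n. r ! i = 1 + card {j. j < n \<and> r ! j < r ! i})"

definition content :: "nat list \<Rightarrow> nat list" where
  "content r = map (\<lambda>i. count_list r i) [1..<length r + 1]"

definition reduced_content :: "nat list \<Rightarrow> nat list" where
  "reduced_content r = filter (\<lambda>c. c \<noteq> 0) (content r)"

definition ascending_subword :: "nat list \<Rightarrow> nat \<Rightarrow> nat \<Rightarrow> bool" where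
  "ascending_subword w i j \<longleftrightarrow>
     i \<le> j \<and> j < length w \<and> (\<forall>l. i \<le> l \<and> l < j \<longrightarrow> w ! l < w ! (l + 1))"

text \<open>A subword is represented by its first and last position, so maximality is maximality
  of the interval of positions.\<close>

definition run_of_ascents :: "nat list \<Rightarrow> nat \<Rightarrow> nat \<Rightarrow> bool" where
  "run_of_ascents w i j \<longleftrightarrow>
     ascending_subword w i j \<and>
     (\<forall>i' j'. i' \<le> i \<and> j \<le> j' \<and> ascending_subword w i' j' \<longrightarrow> i' = i \<and> j' = j)"

definition leading_terms :: "nat list \<Rightarrow> nat list" where
  "leading_terms w = nths w {i. \<exists>j. run_of_ascents w i j}"

definition weakly_flattened :: "nat list \<Rightarrow> bool" where
  "weakly_flattened w \<longleftrightarrow> sorted (leading_terms w)"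

end

theory Submission
  imports Defs "HOL-Library.Multiset"
begin

text \<open>
  A word is weakly flattened exactly when it begins with a least letter and every letter that
  does not exceed its predecessor is a \<^emph>\<open>suffix minimum\<close>, i.e. at most every letter to its right
  (\<open>weakly_flattened_iff_flat\<close>). Indeed the leading terms are the first letter and the letters that
  do not exceed their predecessor, and each letter is at least the leading term of its own run, so
  leading terms that increase weakly bound everything to their right. This form of the condition
  survives the removal of all copies of the largest letter, whereas the runs themselves may merge.

  So flat words can be built by inserting the letters in increasing order of value. Let \<open>w\<close> be flat
  with all letters less than \<open>m\<close>, and insert copies of \<open>m\<close>. Any number \<open>j\<close> of them may go to the
  end. A copy placed in front of a letter \<open>y\<close> of \<open>w\<close> makes \<open>y\<close> a descent, so \<open>y\<close> must be a suffix
  minimum of \<open>w\<close>; it must not be the first letter, and two copies cannot share such a place, because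
  the second would not exceed its predecessor and yet be larger than \<open>y\<close>. Hence, if \<open>w\<close> has \<open>s\<close>
  suffix minima, there are \<open>s - 1\<close> places, and \<open>t + j\<close> copies with \<open>j\<close> at the end can be inserted
  in \<open>s - 1\<close> choose \<open>t\<close> ways (\<open>finite_insertions_and_card\<close>). The suffix minima of the new word are
  those of \<open>w\<close> and the \<open>j\<close> final copies. If \<open>j\<^sub>i\<close> counts the suffix minima equal to the \<open>i\<close>-th
  smallest letter, then all \<open>a\<^sub>1\<close> copies of the least letter are suffix minima, and
  \<open>s = a\<^sub>1 + j\<^sub>2 + \<dots> + j\<^sub>i\<close> after \<open>i\<close> letters. Multiplying the binomial coefficients gives the
  number of flat words with given \<open>j\<^sub>2, \<dots>, j\<^sub>k\<close> (\<open>card_flat_words\<close>), and summing over them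
  the number of all flat words with given letters.

  Finally, the Fubini rankings with reduced content \<open>a\<close> are the rearrangements of one multiset: the
  \<open>i\<close>-th smallest rank is \<open>1 + a\<^sub>1 + \<dots> + a\<^sub>i\<^sub>-\<^sub>1\<close>, with \<open>a\<^sub>i\<close> copies
  (\<open>fubini_ranking_with_reduced_content_iff\<close>). Only the order of the letters matters for the count,
  so it is carried out over an arbitrary linear order.
\<close>

section \<open>Flatness in terms of suffix minima\<close>

fun suffix_minima :: "'a::linorder list \<Rightarrow> 'a list" where
  "suffix_minima [] = []"
| "suffix_minima (x # xs) =
     (if \<forall>y\<in>set xs. x \<le> y then x # suffix_minima xs else suffix_minima xs)"

fun nonascents_to_minima :: "'a::linorder list \<Rightarrow> bool" where
  "nonascents_to_minima [] \<longleftrightarrow> True"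
| "nonascents_to_minima [x] \<longleftrightarrow> True"
| "nonascents_to_minima (x # y # ys) \<longleftrightarrow>
     (x < y \<or> (\<forall>z\<in>set ys. y \<le> z)) \<and> nonascents_to_minima (y # ys)"

definition flat :: "'a::linorder list \<Rightarrow> bool" where
  "flat w \<longleftrightarrow> nonascents_to_minima w \<and> (\<forall>y\<in>set w. hd w \<le> y)"

text \<open>
  Only the left end of a run is constrained by its predecessor; on the right an ascending subword
  can always be prolonged until it is maximal.
\<close>

lemma run_of_ascents_start_iff:
  "(\<exists>j. run_of_ascents w i j) \<longleftrightarrow>
     i < length w \<and> (i = 0 \<or> w ! i \<le> w ! (i - 1))"
proof
  assume "\<exists>j. run_of_ascents w i j"
  then obtain j where j: "ascending_subword w i j"
    and mx: "\<And>i' j'. i' \<le> i \<Longrightarrow> j \<le> j' \<Longrightarrow> ascending_subword w i' j' \<Longrightarrow> i' = i \<and> j' = j"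
    unfolding run_of_ascents_def by blast
  have "w ! i \<le> w ! (i - 1)" if "i \<noteq> 0"
  proof (rule ccontr)
    assume "\<not> w ! i \<le> w ! (i - 1)"
    then have "ascending_subword w (i - 1) j"
      using j that unfolding ascending_subword_def
      by (metis (no_types, lifting) Suc_eq_plus1 Suc_pred' bot_nat_0.not_eq_extremum diff_le_self
          le_trans less_Suc_eq_le linorder_not_le nat_less_le)
    from mx[OF _ _ this] that show False by simp
  qed
  then show "i < length w \<and> (i = 0 \<or> w ! i \<le> w ! (i - 1))"
    using j unfolding ascending_subword_def by linarith
next
  assume i: "i < length w \<and> (i = 0 \<or> w ! i \<le> w ! (i - 1))"
  define j where "j = (GREATEST j. ascending_subword w i j)"
  have ex: "ascending_subword w i i" using i by (simp add: ascending_subword_def)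
  have bd: "\<And>j. ascending_subword w i j \<Longrightarrow> j \<le> length w"
    by (simp add: ascending_subword_def)
  have j: "ascending_subword w i j"
    unfolding j_def using GreatestI_nat[of "ascending_subword w i", OF ex bd] .
  have jmax: "j' \<le> j" if "ascending_subword w i j'" for j'
    unfolding j_def using Greatest_le_nat[of "ascending_subword w i", OF that bd] .
  have "i' = i \<and> j' = j" if h: "i' \<le> i" "j \<le> j'" "ascending_subword w i' j'" for i' j'
  proof -
    have "i \<le> j" using j by (simp add: ascending_subword_def)
    have "i' = i"
    proof (rule ccontr)
      assume "i' \<noteq> i"
      with h have "i' \<le> i - 1" "i - 1 < j'" "i \<noteq> 0" using \<open>i \<le> j\<close> by auto
      then have "w ! (i - 1) < w ! i"
        using h(3) unfolding ascending_subword_def by (metis Suc_eq_plus1 Suc_pred' not_gr0)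
      then show False using i \<open>i \<noteq> 0\<close> by simp
    qed
    then show ?thesis using jmax h by force
  qed
  then show "\<exists>j. run_of_ascents w i j"
    unfolding run_of_ascents_def using j by blast
qed

lemma sorted_nths_iff:
  "sorted (nths (xs :: 'a::linorder list) I) \<longleftrightarrow>
     (\<forall>i j. i < j \<and> j < length xs \<and> i \<in> I \<and> j \<in> I \<longrightarrow> xs ! i \<le> xs ! j)"
proof (induction xs arbitrary: I)
  case (Cons x xs)
  let ?J = "{j. Suc j \<in> I}"
  have "(\<forall>i j. i < j \<and> j < length (x # xs) \<and> i \<in> I \<and> j \<in> I \<longrightarrow> (x # xs) ! i \<le> (x # xs) ! j)
      \<longleftrightarrow> (0 \<in> I \<longrightarrow> (\<forall>j. j < length xs \<and> j \<in> ?J \<longrightarrow> x \<le> xs ! j)) \<and>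
          (\<forall>i j. i < j \<and> j < length xs \<and> i \<in> ?J \<and> j \<in> ?J \<longrightarrow> xs ! i \<le> xs ! j)"
    (is "?L \<longleftrightarrow> ?R")
  proof
    assume L: ?L
    show ?R
    proof (intro conjI allI impI)
      fix j assume "0 \<in> I" "j < length xs \<and> j \<in> ?J"
      then show "x \<le> xs ! j" using L[rule_format, of 0 "Suc j"] by simp
    next
      fix i j assume "i < j \<and> j < length xs \<and> i \<in> ?J \<and> j \<in> ?J"
      then show "xs ! i \<le> xs ! j" using L[rule_format, of "Suc i" "Suc j"] by simp
    qed
  next
    assume R: ?R
    show ?L
    proof (intro allI impI)
      fix i j assume h: "i < j \<and> j < length (x # xs) \<and> i \<in> I \<and> j \<in> I"
      then obtain j' where "j = Suc j'" by (cases j) auto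
      then show "(x # xs) ! i \<le> (x # xs) ! j" using h R by (cases i) auto
    qed
  qed
  then show ?case
    using Cons.IH[of ?J] by (auto simp: nths_Cons set_nths)
qed simp

lemma nonascents_to_minima_iff_nth:
  "nonascents_to_minima w \<longleftrightarrow>
     (\<forall>i q. Suc i \<le> q \<and> q < length w \<and> w ! Suc i \<le> w ! i \<longrightarrow> w ! Suc i \<le> w ! q)"
proof (induction w rule: nonascents_to_minima.induct)
  case (3 x y ys)
  let ?w = "x # y # ys"
  have "(\<forall>i q. Suc i \<le> q \<and> q < length ?w \<and> ?w ! Suc i \<le> ?w ! i \<longrightarrow> ?w ! Suc i \<le> ?w ! q)
    \<longleftrightarrow> (\<forall>q. 1 \<le> q \<and> q < length ?w \<and> y \<le> x \<longrightarrow> y \<le> ?w ! q) \<and>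
        (\<forall>i q. Suc i \<le> q \<and> q < length (y # ys) \<and> (y # ys) ! Suc i \<le> (y # ys) ! i
              \<longrightarrow> (y # ys) ! Suc i \<le> (y # ys) ! q)" (is "?L \<longleftrightarrow> ?R")
  proof
    assume L: ?L
    show ?R
    proof (intro conjI allI impI)
      fix q assume "1 \<le> q \<and> q < length ?w \<and> y \<le> x"
      then show "y \<le> ?w ! q" using L[rule_format, of 0 q] by simp
    next
      fix i q assume "Suc i \<le> q \<and> q < length (y # ys) \<and> (y # ys) ! Suc i \<le> (y # ys) ! i"
      then show "(y # ys) ! Suc i \<le> (y # ys) ! q"
        using L[rule_format, of "Suc i" "Suc q"] by simp
    qed
  next
    assume R: ?R
    show ?L
    proof (intro allI impI)
      fix i q assume h: "Suc i \<le> q \<and> q < length ?w \<and> ?w ! Suc i \<le> ?w ! i"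
      then obtain q' where q: "q = Suc q'" by (cases q) auto
      show "?w ! Suc i \<le> ?w ! q"
      proof (cases i)
        case 0
        then show ?thesis using R h by auto
      next
        case (Suc i')
        then show ?thesis using R[THEN conjunct2, rule_format, of i' q'] h q by simp
      qed
    qed
  qed
  moreover have "(\<forall>q. 1 \<le> q \<and> q < length ?w \<and> y \<le> x \<longrightarrow> y \<le> ?w ! q) \<longleftrightarrow>
      x < y \<or> (\<forall>z\<in>set ys. y \<le> z)"
  proof -
    have "(\<forall>q. 1 \<le> q \<and> q < length ?w \<longrightarrow> y \<le> ?w ! q) \<longleftrightarrow> (\<forall>q < length (y # ys). y \<le> (y # ys) ! q)"
      by (metis One_nat_def Suc_le_eq Suc_less_eq length_Cons nth_Cons_Suc not0_implies_Suc not_gr0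
          zero_less_Suc)
    also have "\<dots> \<longleftrightarrow> (\<forall>z\<in>set ys. y \<le> z)"
      by (metis in_set_conv_nth list.set_intros(1,2) order_refl set_ConsD)
    finally show ?thesis by (meson linorder_not_le)
  qed
  ultimately show ?case using 3 by simp
qed simp_all

text \<open>
  Sortedness compares leading terms only. Walking to the right from a leading term \<open>i\<close>, each letter
  either is a leading term, hence at least the letter at \<open>i\<close>, or exceeds its predecessor; so the
  letter at \<open>i\<close> bounds all letters to its right.
\<close>

lemma weakly_flattened_iff_flat: "weakly_flattened w \<longleftrightarrow> flat w"
proof -
  let ?lead = "\<lambda>i. i < length w \<and> (i = 0 \<or> w ! i \<le> w ! (i - 1))"
  have wf: "weakly_flattened w \<longleftrightarrow>
      (\<forall>i q. i < q \<and> ?lead i \<and> ?lead q \<longrightarrow> w ! i \<le> w ! q)"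
    unfolding weakly_flattened_def leading_terms_def sorted_nths_iff run_of_ascents_start_iff
    by auto
  have "weakly_flattened w \<longleftrightarrow> (\<forall>i q. i \<le> q \<and> q < length w \<and> ?lead i \<longrightarrow> w ! i \<le> w ! q)"
    (is "_ \<longleftrightarrow> ?all")
  proof
    assume L: "weakly_flattened w"
    have "w ! i \<le> w ! q" if "?lead i" "i \<le> q" "q < length w" for i q
      using that(2,3)
    proof (induction q rule: dec_induct)
      case (step q)
      show ?case
      proof (cases "w ! Suc q \<le> w ! q")
        case True
        then have "?lead (Suc q)" using step.prems by simp
        then show ?thesis
          using L[unfolded wf, rule_format, of i "Suc q"] that(1) step.hyps by linarith
      next
        case False
        then show ?thesis using step by simp
      qed
    qed simp
    then show ?all by blast
  next
    assume ?all
    then show "weakly_flattened w" unfolding wf using less_imp_le by metis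
  qed
  also have "\<dots> \<longleftrightarrow> flat w"
  proof -
    have "(\<forall>y\<in>set w. hd w \<le> y) \<longleftrightarrow> (\<forall>q<length w. w ! 0 \<le> w ! q)"
      by (cases "w = []") (auto simp: all_set_conv_all_nth hd_conv_nth)
    moreover have "?all \<longleftrightarrow> (\<forall>q<length w. w ! 0 \<le> w ! q) \<and>
      (\<forall>i q. Suc i \<le> q \<and> q < length w \<and> w ! Suc i \<le> w ! i \<longrightarrow> w ! Suc i \<le> w ! q)"
      (is "_ \<longleftrightarrow> ?R")
    proof
      assume A: ?all
      show ?R
      proof (intro conjI allI impI)
        fix q assume "q < length w"
        then show "w ! 0 \<le> w ! q" using A[rule_format, of 0 q] by (cases w) auto
      next
        fix i q assume "Suc i \<le> q \<and> q < length w \<and> w ! Suc i \<le> w ! i"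
        then show "w ! Suc i \<le> w ! q" using A[rule_format, of "Suc i" q] by auto
      qed
    next
      assume R: ?R
      show ?all
      proof (intro allI impI)
        fix i q assume "i \<le> q \<and> q < length w \<and> ?lead i"
        then show "w ! i \<le> w ! q" using R by (cases i) auto
      qed
    qed
    ultimately show ?thesis unfolding flat_def nonascents_to_minima_iff_nth by blast
  qed
  finally show ?thesis .
qed

lemma set_suffix_minima_subset: "set (suffix_minima w) \<subseteq> set w"
  by (induction w) auto

lemma count_suffix_minima_le: "count_list (suffix_minima w) x \<le> count_list w x"
  by (induction w) auto

lemma count_suffix_minima_least:
  "\<forall>y\<in>set w. x \<le> y \<Longrightarrow> count_list (suffix_minima w) x = count_list w x"
  by (induction w) auto

section \<open>Removing and inserting the largest letter\<close>

text \<open>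
  Larger letters never prevent a smaller one from being a suffix minimum.
\<close>

lemma suffix_minima_filter_less:
  "suffix_minima (filter (\<lambda>z. z < m) v) = filter (\<lambda>z. z < m) (suffix_minima v)"
proof (induction v)
  case (Cons x v)
  have "(\<forall>y\<in>set v. y < m \<longrightarrow> x \<le> y) \<longleftrightarrow> (\<forall>y\<in>set v. x \<le> y)" if "x < m"
    using that by force
  then show ?case using Cons by auto
qed simp

text \<open>
  Removing copies of \<open>m\<close> creates new neighbours \<open>x\<close>, \<open>z\<close> only where some \<open>m\<close> stood between them.
  Then \<open>z\<close> was smaller than its predecessor, hence a suffix minimum, and so the new pair is harmless
  even if it is not an ascent.
\<close>

lemma nonascents_to_minima_filter_less:
  assumes "nonascents_to_minima v" "\<forall>x\<in>set v. x \<le> m"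
  shows "nonascents_to_minima (filter (\<lambda>z. z < m) v)"
  using assms
proof (induction v rule: nonascents_to_minima.induct)
  case (3 x y ys)
  have IH: "nonascents_to_minima (filter (\<lambda>z. z < m) (y # ys))" using 3 by simp
  show ?case
  proof (cases "x < m \<and> \<not> y < m")
    case False
    then show ?thesis using IH 3(2) by auto
  next
    case True
    then have y: "y = m" using 3(3) by force
    show ?thesis
    proof (cases ys)
      case (Cons z zs)
      have "\<forall>u\<in>set zs. z \<le> u" using 3(2,3) Cons y by auto
      then have low: "\<forall>u\<in>set (filter (\<lambda>z. z < m) zs). z \<le> u" by simp
      show ?thesis
      proof (cases "z < m")
        case True
        then show ?thesis using IH low \<open>x < m \<and> \<not> y < m\<close> Cons by simp
      next
        case False
        then have "filter (\<lambda>z. z < m) zs = []" using low by (force simp: filter_empty_conv)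
        then show ?thesis using False \<open>x < m \<and> \<not> y < m\<close> Cons by simp
      qed
    qed (use True in simp)
  qed
qed simp_all

text \<open>
  The admissible ways to insert \<open>t + j\<close> copies of \<open>m\<close> into \<open>w\<close>. As \<open>m\<close> is the largest letter, a copy
  of \<open>m\<close> is a suffix minimum iff nothing smaller follows it, so \<open>j\<close> is the number of copies at the
  end and \<open>t\<close> that of the copies inside \<open>w\<close>. The condition on the heads keeps the first letter in
  front.
\<close>

definition insertions :: "'a::linorder \<Rightarrow> 'a list \<Rightarrow> nat \<Rightarrow> nat \<Rightarrow> 'a list set" where
  "insertions m w t j = {v. filter (\<lambda>z. z < m) v = w \<and> (\<forall>z\<in>set v. z \<le> m) \<and>
     v \<noteq> [] \<and> hd v = hd w \<and> nonascents_to_minima v \<and>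
     count_list v m = t + j \<and> count_list (suffix_minima v) m = j}"

lemma nonascents_to_minima_replicate [simp]: "nonascents_to_minima (replicate n x)"
proof (induction n)
  case (Suc n) then show ?case by (cases n) auto
qed simp

lemma suffix_minima_replicate [simp]: "suffix_minima (replicate n x) = replicate n x"
  by (induction n) auto

lemma count_list_replicate_same [simp]: "count_list (replicate n x) x = n"
  by (induction n) auto

lemma insertions_singleton:
  assumes "x < m"
  shows "insertions m [x] t j = (if t = 0 then {x # replicate j m} else {})"
proof -
  have rep: "v = x # replicate (t + j) m \<and> t = 0" if "v \<in> insertions m [x] t j" for v
  proof -
    from that obtain v' where v: "v = x # v'" unfolding insertions_def by (cases v) auto
    have "filter (\<lambda>z. z < m) v' = []" "\<forall>z\<in>set v'. z \<le> m" "count_list v' m = t + j"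
      using that assms v unfolding insertions_def by auto
    then have all: "\<forall>z\<in>set v'. z = m" by (force simp: filter_empty_conv)
    then have "v' = replicate (length v') m" by (simp add: replicate_length_same)
    moreover from this have "length v' = t + j"
      using \<open>count_list v' m = t + j\<close> by (metis count_list_replicate_same)
    ultimately have v': "v' = replicate (t + j) m" by simp
    have "count_list (suffix_minima v') m = j"
      using that assms v unfolding insertions_def by (auto split: if_splits)
    then show ?thesis using v v' by simp
  qed
  moreover have "x # replicate j m \<in> insertions m [x] 0 j"
  proof -
    have "nonascents_to_minima (x # replicate j m)"
      using assms nonascents_to_minima_replicate[of j m] by (cases j) auto
    then show ?thesis using assms unfolding insertions_def by auto
  qed
  ultimately show ?thesis by auto
qed

text \<open>
  Between the first two letters \<open>x\<close> and \<open>y\<close> there is no \<open>m\<close>, or exactly one, and the latter requires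
  \<open>y\<close> to be a suffix minimum. In both cases what follows is an insertion into the tail.
\<close>

lemma insertions_Cons_Cons:
  assumes "x < m" "y < m" and good: "nonascents_to_minima (x # y # ys)"
  shows "insertions m (x # y # ys) t j =
    (#) x ` insertions m (y # ys) t j \<union>
    (if (\<forall>z\<in>set ys. y \<le> z) \<and> t > 0
     then (\<lambda>u. x # m # u) ` insertions m (y # ys) (t - 1) j else {})"
    (is "?L = ?R1 \<union> ?R2")
proof (intro equalityI subsetI)
  fix v assume v: "v \<in> ?L"
  then obtain v' where v': "v = x # v'" unfolding insertions_def by (cases v) auto
  have f: "filter (\<lambda>z. z < m) v' = y # ys" using v v' assms unfolding insertions_def by auto
  then have "v' \<noteq> []" by auto
  then obtain h u where u: "v' = h # u" by (cases v') auto
  have g': "nonascents_to_minima v'" and gx: "x < h \<or> (\<forall>z\<in>set u. h \<le> z)"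
    using v v' u unfolding insertions_def by auto
  have sm: "count_list (suffix_minima v') m = j" "count_list v' m = t + j" "\<forall>z\<in>set v'. z \<le> m"
    using v v' assms unfolding insertions_def by (auto split: if_splits)
  show "v \<in> ?R1 \<union> ?R2"
  proof (cases "h < m")
    case True
    then have "h = y" using f u by simp
    then have "v' \<in> insertions m (y # ys) t j"
      using f g' sm u unfolding insertions_def by simp
    then show ?thesis using v' by blast
  next
    case False
    then have h: "h = m" using sm u by auto
    have fu: "filter (\<lambda>z. z < m) u = y # ys" using f u h by simp
    then have "u \<noteq> []" by auto
    then obtain g u' where u': "u = g # u'" by (cases u) auto
    have "g \<le> m" using sm u u' by auto
    \<comment> \<open>The letter \<open>g\<close> after \<open>m\<close> does not exceed \<open>m\<close>, so it is a suffix minimum. Hence it is at most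
      \<open>y\<close>, so it is less than \<open>m\<close>, and the first such letter is \<open>y\<close> itself.\<close>
    have low: "\<forall>z\<in>set u'. g \<le> z" using g' u u' h \<open>g \<le> m\<close> by auto
    have yu: "y \<in> set u" using arg_cong[OF fu, of set] by auto
    have "g \<le> y" using low yu u' by auto
    then have "g = y" using fu u' assms by (auto split: if_splits)
    have "set ys \<subseteq> set u'" using fu u' \<open>g = y\<close> assms(2) by auto
    then have lowys: "\<forall>z\<in>set ys. y \<le> z" using low \<open>g = y\<close> by auto
    have "\<not> (\<forall>z\<in>set u. m \<le> z)" using yu assms(2) by force
    then have smu: "count_list (suffix_minima u) m = j" using sm u h by auto
    \<comment> \<open>The \<open>m\<close> just found is not a suffix minimum, so it is one of the \<open>t\<close> inner copies.\<close>
    have cu: "Suc (count_list u m) = t + j" using sm u h by simp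
    moreover have "j \<le> count_list u m" using smu count_suffix_minima_le by metis
    ultimately have t: "t > 0" by simp
    have "u \<in> insertions m (y # ys) (t - 1) j"
      using fu g' u h sm u' \<open>g = y\<close> smu cu t unfolding insertions_def by auto
    then show ?thesis using v' u h lowys t by auto
  qed
next
  fix v assume "v \<in> ?R1 \<union> ?R2"
  then consider u where "v = x # u" "u \<in> insertions m (y # ys) t j"
    | u where "v = x # m # u" "u \<in> insertions m (y # ys) (t - 1) j" "t > 0"
        "\<forall>z\<in>set ys. y \<le> z"
    by (auto split: if_splits)
  then show "v \<in> ?L"
  proof cases
    case 1
    from 1(2) obtain u' where u: "u = y # u'" unfolding insertions_def by (cases u) auto
    have fu: "filter (\<lambda>z. z < m) u' = ys" using 1 u assms unfolding insertions_def by auto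
    have "x < y \<or> (\<forall>z\<in>set u'. y \<le> z)"
    proof (cases "x < y")
      case False
      then have "\<forall>z\<in>set ys. y \<le> z" using good by auto
      then have "\<forall>z\<in>set u'. z < m \<longrightarrow> y \<le> z" using fu by auto
      then show ?thesis using assms(2) by force
    qed simp
    then show ?thesis using 1 u assms unfolding insertions_def by auto
  next
    case 2
    from 2(2) obtain u' where u: "u = y # u'" unfolding insertions_def by (cases u) auto
    have fu: "filter (\<lambda>z. z < m) u' = ys" using 2 u assms unfolding insertions_def by auto
    have "\<forall>z\<in>set u'. z < m \<longrightarrow> y \<le> z" using fu 2(4) by auto
    then have "\<forall>z\<in>set u'. y \<le> z" using assms(2) by force
    then show ?thesis using 2 u assms unfolding insertions_def by auto
  qed
qed

text \<open>
  The recursion of \<open>insertions_Cons_Cons\<close> is Pascal's rule if \<open>y\<close> is a suffix minimum; otherwise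
  the place in front of \<open>y\<close> is barred. The tail of \<open>w\<close> appears because
  nothing may stand in front of the first letter.
\<close>

lemma finite_insertions_and_card:
  assumes "w \<noteq> []" "\<forall>z\<in>set w. z < m" "nonascents_to_minima w"
  shows "finite (insertions m w t j) \<and>
    card (insertions m w t j) = length (suffix_minima (tl w)) choose t"
  using assms
proof (induction w arbitrary: t rule: nonascents_to_minima.induct)
  case (2 x)
  then show ?case by (cases t) (auto simp: insertions_singleton)
next
  case (3 x y ys)
  have IH: "finite (insertions m (y # ys) t j)"
    "card (insertions m (y # ys) t j) = length (suffix_minima ys) choose t" for t
    using 3 by auto
  have hd: "hd u = y \<and> u \<noteq> []" if "u \<in> insertions m (y # ys) t j" for u t
    using that unfolding insertions_def by auto
  note rec = insertions_Cons_Cons[of x m y ys t j]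
  let ?A = "(#) x ` insertions m (y # ys) t j"
  let ?B = "(\<lambda>u. x # m # u) ` insertions m (y # ys) (t - 1) j"
  have cA: "card ?A = length (suffix_minima ys) choose t" "finite ?A"
    using IH by (auto simp: card_image inj_on_def)
  have cB: "card ?B = length (suffix_minima ys) choose (t - 1)" "finite ?B"
    using IH by (auto simp: card_image inj_on_def)
  have dis: "?A \<inter> ?B = {}" using hd 3(3) by fastforce
  show ?case
  proof (cases "(\<forall>z\<in>set ys. y \<le> z) \<and> t > 0")
    case True
    then have "insertions m (x # y # ys) t j = ?A \<union> ?B" using rec 3 by simp
    then have "finite (insertions m (x # y # ys) t j)"
      "card (insertions m (x # y # ys) t j) = card ?A + card ?B"
      using cA cB dis by (simp_all add: card_Un_disjoint)
    then show ?thesis using True cA cB by (cases t) auto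
  next
    case False
    then have "insertions m (x # y # ys) t j = ?A" using rec 3 by auto
    then show ?thesis using False cA by (cases t) auto
  qed
qed simp

lemma count_list_filter: "P x \<Longrightarrow> count_list (filter P xs) x = count_list xs x"
  by (induction xs) auto

lemma flat_filter_less:
  assumes "flat v" "\<forall>x\<in>set v. x \<le> m" "filter (\<lambda>z. z < m) v \<noteq> []"
  shows "flat (filter (\<lambda>z. z < m) v)" "hd (filter (\<lambda>z. z < m) v) = hd v"
proof -
  obtain y where y: "y \<in> set v" "y < m" using assms(3) by (auto simp: filter_empty_conv)
  then obtain x v' where v: "v = x # v'" by (cases v) auto
  have "x \<le> y" using assms(1) v y(1) unfolding flat_def by auto
  then have "x < m" using y(2) by simp
  then show hd: "hd (filter (\<lambda>z. z < m) v) = hd v" using v by simp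
  show "flat (filter (\<lambda>z. z < m) v)"
    using assms(1,2) nonascents_to_minima_filter_less[of v m] unfolding flat_def hd by auto
qed

lemma flat_if_insertions:
  assumes "v \<in> insertions m w t j" "flat w" "w \<noteq> []"
  shows "flat v"
proof -
  have v: "filter (\<lambda>z. z < m) v = w" "\<forall>z\<in>set v. z \<le> m" "hd v = hd w" "nonascents_to_minima v"
    using assms(1) unfolding insertions_def by auto
  have "hd w \<in> set (filter (\<lambda>z. z < m) v)" using v(1) assms(3) by simp
  then have "hd w < m" by simp
  have "hd w \<le> y" if "y \<in> set v" for y
  proof (cases "y < m")
    case True
    then have "y \<in> set w" using that v(1) by auto
    then show ?thesis using assms(2) unfolding flat_def by blast
  next
    case False
    then show ?thesis using \<open>hd w < m\<close> by simp
  qed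
  then show ?thesis using v unfolding flat_def by simp
qed

section \<open>Counting flat words with given letters\<close>

definition letters :: "(nat \<Rightarrow> nat) \<Rightarrow> (nat \<Rightarrow> 'a) \<Rightarrow> nat \<Rightarrow> 'a multiset" where
  "letters a b k = (\<Sum>l=1..k. replicate_mset (a l) (b l))"

lemma letters_Suc: "letters a b (Suc k) = letters a b k + replicate_mset (a (Suc k)) (b (Suc k))"
  by (simp add: letters_def)

lemma set_letters_subset: "set_mset (letters a b k) \<subseteq> b ` {1..k}"
  by (auto simp: letters_def set_mset_sum)

lemma count_letters:
  assumes "inj_on b {1..k}" "l \<in> {1..k}"
  shows "count (letters a b k) (b l) = a l"
proof -
  have "count (letters a b k) (b l) = (\<Sum>i=1..k. if i = l then a i else 0)"
    unfolding letters_def count_sum using assms by (intro sum.cong) (auto simp: inj_on_eq_iff)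
  then show ?thesis using assms(2) by simp
qed

text \<open>
  The flat words refined by their numbers of suffix minima. The value \<open>j 1\<close> is left out, since all
  copies of the least letter are suffix minima.
\<close>

definition flat_words ::
    "(nat \<Rightarrow> nat) \<Rightarrow> (nat \<Rightarrow> 'a::linorder) \<Rightarrow> nat \<Rightarrow> (nat \<Rightarrow> nat) \<Rightarrow> 'a list set" where
  "flat_words a b k j = {w. mset w = letters a b k \<and> flat w \<and>
     (\<forall>l\<in>{2..k}. count_list (suffix_minima w) (b l) = j l)}"

lemma finite_flat_words: "finite (flat_words a b k j)"
proof -
  obtain ys where "mset ys = letters a b k" using ex_mset by blast
  then show ?thesis
    using mset_eq_finite[of ys] by (auto simp: flat_words_def intro: finite_subset[rotated])
qed

lemma length_suffix_minima_flat_words: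
  assumes w: "w \<in> flat_words a b k j" and b: "strict_mono_on {1..k} b" and k: "k \<ge> 1"
  shows "length (suffix_minima w) = a 1 + (\<Sum>r=2..k. j r)"
proof -
  have inj: "inj_on b {1..k}" using b by (rule strict_mono_on_imp_inj_on)
  have mw: "mset w = letters a b k" using w by (simp add: flat_words_def)
  have set_w: "set w \<subseteq> b ` {1..k}"
    using set_letters_subset[of a b k] mw by (metis set_mset_mset)
  have "b 1 \<le> y" if "y \<in> set w" for y
  proof -
    obtain l where "l \<in> {1..k}" "y = b l" using set_w \<open>y \<in> set w\<close> by blast
    then show ?thesis using b k by (cases "l = 1") (auto simp: strict_mono_on_def less_imp_le)
  qed
  then have "count_list (suffix_minima w) (b 1) = count_list w (b 1)"
    using count_suffix_minima_least by blast
  also have "\<dots> = a 1" using count_letters[OF inj, of 1 a] k mw by (simp flip: count_mset)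
  finally have c1: "count_list (suffix_minima w) (b 1) = a 1" .
  have "length (suffix_minima w) = sum (count_list (suffix_minima w)) (b ` {1..k})"
    using set_suffix_minima_subset[of w] set_w by (intro sum_count_set[symmetric]) auto
  also have "\<dots> = (\<Sum>l=1..k. count_list (suffix_minima w) (b l))"
    using inj by (simp add: sum.reindex)
  also have "\<dots> = a 1 + (\<Sum>l=2..k. count_list (suffix_minima w) (b l))"
    using k c1 by (simp add: sum.atLeast_Suc_atMost numeral_2_eq_2)
  also have "(\<Sum>l=2..k. count_list (suffix_minima w) (b l)) = (\<Sum>l=2..k. j l)"
    using w by (intro sum.cong) (auto simp: flat_words_def)
  finally show ?thesis .
qed

text \<open>
  Deleting the largest letter sorts the flat words into fibres, and these are sets of insertions: the
  deletion changes neither flatness nor the suffix minima among the smaller letters.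
\<close>

lemma flat_words_Suc:
  assumes b: "strict_mono_on {1..Suc k} b" and k: "k \<ge> 1" and a1: "a 1 > 0"
    and ja: "j (Suc k) \<le> a (Suc k)"
  shows "flat_words a b (Suc k) j =
    (\<Union>w\<in>flat_words a b k j.
       insertions (b (Suc k)) w (a (Suc k) - j (Suc k)) (j (Suc k)))"
    (is "_ = (\<Union>w\<in>_. insertions ?m w ?t ?j)")
proof -
  have inj: "inj_on b {1..k}"
    using b strict_mono_on_imp_inj_on inj_on_subset
    by (metis atLeastatMost_subset_iff le_SucI order_refl)
  have less: "b l < ?m" if "l \<in> {1..k}" for l
    using b that by (auto simp: strict_mono_on_def)
  have lk: "z < ?m" if "z \<in># letters a b k" for z
    using that less set_letters_subset[of a b k] by auto
  have ne: "letters a b k \<noteq> {#}"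
    using count_letters[OF inj, of 1 a] a1 k by auto
  show ?thesis
  proof (intro equalityI subsetI)
    fix v assume v: "v \<in> flat_words a b (Suc k) j"
    let ?w = "filter (\<lambda>z. z < ?m) v"
    have mv: "mset v = letters a b k + replicate_mset (a (Suc k)) ?m"
      using v by (simp add: flat_words_def letters_Suc)
    have fv: "flat v" using v by (simp add: flat_words_def)
    have "filter_mset (\<lambda>z. z < ?m) (letters a b k) = letters a b k"
      using lk by (simp add: filter_mset_eq_conv)
    moreover have "filter_mset (\<lambda>z. z < ?m) (replicate_mset (a (Suc k)) ?m) = {#}" by auto
    ultimately have mw: "mset ?w = letters a b k" using mv by simp
    then have w0: "?w \<noteq> []" using ne by (metis mset_zero_iff)
    have "z \<in># mset v \<Longrightarrow> z \<le> ?m" for z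
      using lk unfolding mv by (auto split: if_splits intro: less_imp_le)
    then have le: "\<forall>z\<in>set v. z \<le> ?m" by simp
    have "count (letters a b k) ?m = 0" using lk by (auto simp: count_eq_zero_iff)
    then have cm: "count_list v ?m = a (Suc k)" using mv by (simp flip: count_mset)
    have cl: "count_list (suffix_minima v) (b l) = j l" if "l \<in> {2..Suc k}" for l
      using v that by (simp add: flat_words_def)
    have "count_list (suffix_minima ?w) (b l) = j l" if "l \<in> {2..k}" for l
      using cl[of l] that less[of l] by (simp add: suffix_minima_filter_less count_list_filter)
    then have "?w \<in> flat_words a b k j"
      using mw flat_filter_less(1)[OF fv le w0] by (simp add: flat_words_def)
    moreover have "v \<in> insertions ?m ?w ?t ?j"
      using fv le w0 flat_filter_less(2)[OF fv le w0] cm cl[of "Suc k"] ja k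
      unfolding insertions_def flat_def by auto
    ultimately show "v \<in> (\<Union>w\<in>flat_words a b k j. insertions ?m w ?t ?j)" by blast
  next
    fix v assume "v \<in> (\<Union>w\<in>flat_words a b k j. insertions ?m w ?t ?j)"
    then obtain w where w: "w \<in> flat_words a b k j" and v: "v \<in> insertions ?m w ?t ?j" by blast
    have mw: "mset w = letters a b k" using w by (simp add: flat_words_def)
    have v': "filter (\<lambda>z. z < ?m) v = w" "\<forall>z\<in>set v. z \<le> ?m" "count_list v ?m = a (Suc k)"
      "count_list (suffix_minima v) ?m = ?j"
      using v ja unfolding insertions_def by auto
    have "mset v = filter_mset (\<lambda>z. z < ?m) (mset v) + filter_mset (\<lambda>z. \<not> z < ?m) (mset v)"
      by (rule multiset_partition)
    also have "filter_mset (\<lambda>z. \<not> z < ?m) (mset v) = filter_mset (\<lambda>z. z = ?m) (mset v)"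
      using v'(2) by (intro filter_mset_cong) force+
    also have "\<dots> = replicate_mset (a (Suc k)) ?m"
      using v'(3) by (simp add: filter_eq_replicate_mset flip: count_mset)
    also have "filter_mset (\<lambda>z. z < ?m) (mset v) = letters a b k"
      using v'(1) mw by (metis mset_filter)
    finally have mv: "mset v = letters a b (Suc k)" by (simp add: letters_Suc)
    have "count_list (suffix_minima v) (b l) = j l" if l: "l \<in> {2..Suc k}" for l
    proof (cases "l = Suc k")
      case False
      then have l': "l \<in> {2..k}" using l by auto
      then have "count_list (suffix_minima w) (b l) = j l" using w by (simp add: flat_words_def)
      then show ?thesis
        using less[of l] l' by (simp add: suffix_minima_filter_less count_list_filter flip: v'(1))
    qed (use v' in simp)
    moreover have "flat v"
      using flat_if_insertions[OF v] w mw ne by (force simp: flat_words_def)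
    ultimately show "v \<in> flat_words a b (Suc k) j"
      using mv by (simp add: flat_words_def)
  qed
qed

lemma card_flat_words:
  assumes "k \<ge> 1" "strict_mono_on {1..k} b" "a 1 > 0" "\<forall>i\<in>{2..k}. j i \<le> a i"
  shows "card (flat_words a b k j) =
    (\<Prod>i=2..k. (a 1 + (\<Sum>r=2..i - 1. j r) - 1) choose (a i - j i))"
  using assms
proof (induction k rule: dec_induct)
  case base
  have "w = replicate (a 1) (b 1)" if "mset w = replicate_mset (a 1) (b 1)" for w
  proof (rule replicate_eqI)
    show "length w = a 1" using arg_cong[OF that, of size] by simp
    show "y = b 1" if "y \<in> set w" for y
      using \<open>y \<in> set w\<close> arg_cong[OF \<open>mset w = _\<close>, of set_mset] by (auto split: if_splits)
  qed
  then have "flat_words a b 1 j = {replicate (a 1) (b 1)}"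
    using base by (auto simp: flat_words_def letters_def flat_def)
  then show ?case by simp
next
  case (step k)
  let ?m = "b (Suc k)" and ?t = "a (Suc k) - j (Suc k)"
  have b: "strict_mono_on {1..k} b"
    using step.prems(1) by (auto simp: strict_mono_on_def)
  have inj: "inj_on b {1..k}" using b by (rule strict_mono_on_imp_inj_on)
  have fib: "finite (insertions ?m w ?t (j (Suc k))) \<and> card (insertions ?m w ?t (j (Suc k))) =
      (a 1 + (\<Sum>r=2..k. j r) - 1) choose ?t" if w: "w \<in> flat_words a b k j" for w
  proof -
    have mw: "mset w = letters a b k" and fw: "flat w" using w by (auto simp: flat_words_def)
    have "set w \<subseteq> b ` {1..k}"
      using set_letters_subset[of a b k] mw by (metis set_mset_mset)
    then have lt: "\<forall>z\<in>set w. z < ?m"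
      using step.prems(1) by (force simp: strict_mono_on_def)
    have "count_list w (b 1) = a 1"
      using mw count_letters[OF inj, of 1 a] step.hyps by (simp flip: count_mset)
    then have w0: "w \<noteq> []" using step.prems(2) by auto
    then have "length (suffix_minima w) = Suc (length (suffix_minima (tl w)))"
      using fw by (cases w) (auto simp: flat_def)
    then show ?thesis
      using finite_insertions_and_card[OF w0 lt, of ?t "j (Suc k)"] fw
        length_suffix_minima_flat_words[OF w b] step.hyps by (simp add: flat_def)
  qed
  have Suc: "flat_words a b (Suc k) j =
      (\<Union>w\<in>flat_words a b k j. insertions ?m w ?t (j (Suc k)))"
    using step by (intro flat_words_Suc) auto
  have "card (flat_words a b (Suc k) j) =
      (\<Sum>w\<in>flat_words a b k j. card (insertions ?m w ?t (j (Suc k))))"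
    unfolding Suc
  proof (intro card_UN_disjoint finite_flat_words ballI impI)
    show "finite (insertions ?m w ?t (j (Suc k)))" if "w \<in> flat_words a b k j" for w
      using fib[OF that] by (rule conjunct1)
    show "insertions ?m w ?t (j (Suc k)) \<inter> insertions ?m w' ?t (j (Suc k)) = {}"
      if "w \<noteq> w'" for w w'
      using that by (auto simp: insertions_def)
  qed
  also have "\<dots> = (\<Sum>w\<in>flat_words a b k j. (a 1 + (\<Sum>r=2..k. j r) - 1) choose ?t)"
    by (intro sum.cong refl conjunct2[OF fib])
  also have "\<dots> = card (flat_words a b k j) * ((a 1 + (\<Sum>r=2..k. j r) - 1) choose ?t)"
    by (simp only: sum_constant of_nat_id)
  also have "card (flat_words a b k j) =
      (\<Prod>i=2..k. (a 1 + (\<Sum>r=2..i - 1. j r) - 1) choose (a i - j i))"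
    using step.prems b by (intro step.IH) auto
  finally show ?case using step.hyps by simp
qed

text \<open>
  Every flat word belongs to exactly one family \<open>j\<close> in the function space: the requirement
  \<open>j i \<le> a i\<close> holds because suffix minima are among the letters, and extensionality makes \<open>j\<close> unique.
\<close>

lemma card_flat_words_with_letters:
  assumes "k \<ge> 1" "strict_mono_on {1..k} b" "a 1 > 0"
  shows "card {w. mset w = letters a b k \<and> flat w} =
    (\<Sum>j \<in> (\<Pi>\<^sub>E i\<in>{2..k}. {0..a i}).
       \<Prod>i=2..k. (a 1 + (\<Sum>r=2..i - 1. j r) - 1) choose (a i - j i))"
proof -
  let ?J = "\<Pi>\<^sub>E i\<in>{2..k}. {0..a i}"
  have inj: "inj_on b {1..k}" using assms(2) by (rule strict_mono_on_imp_inj_on)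
  have "\<exists>j\<in>?J. w \<in> flat_words a b k j" if w: "mset w = letters a b k" "flat w" for w
  proof
    let ?j = "\<lambda>i\<in>{2..k}. count_list (suffix_minima w) (b i)"
    show "w \<in> flat_words a b k ?j" using w by (simp add: flat_words_def)
    have "count_list (suffix_minima w) (b i) \<le> a i" if "i \<in> {2..k}" for i
      using count_suffix_minima_le[of w "b i"] count_letters[OF inj, of i a] that w(1)
      by (simp flip: count_mset)
    then show "?j \<in> ?J" by (auto simp: PiE_iff)
  qed
  then have "{w. mset w = letters a b k \<and> flat w} = (\<Union>j\<in>?J. flat_words a b k j)"
    by (auto simp: flat_words_def)
  also have "card \<dots> = (\<Sum>j\<in>?J. card (flat_words a b k j))"
  proof (intro card_UN_disjoint ballI impI)
    show "finite ?J" by (intro finite_PiE) auto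
    fix j j' assume J: "j \<in> ?J" "j' \<in> ?J" "j \<noteq> j'"
    then obtain i where "i \<in> {2..k}" "j i \<noteq> j' i" using PiE_ext by metis
    then show "flat_words a b k j \<inter> flat_words a b k j' = {}"
      by (auto simp: flat_words_def)
  qed (rule finite_flat_words)
  also have "\<dots> = (\<Sum>j\<in>?J. \<Prod>i=2..k. (a 1 + (\<Sum>r=2..i - 1. j r) - 1) choose (a i - j i))"
  proof (intro sum.cong refl card_flat_words assms ballI)
    fix j i assume "j \<in> ?J" "i \<in> {2..k}"
    then show "j i \<le> a i" by (auto simp: PiE_iff)
  qed
  finally show ?thesis .
qed

section \<open>Fubini rankings with given reduced content\<close>

lemma length_filter_eq_sum_count:
  "length (filter P r) = (\<Sum>y | y \<in> set r \<and> P y. count_list r y)"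
proof -
  have "length (filter P r) = (\<Sum>y | y \<in> set r \<and> P y. count_list (filter P r) y)"
    by (rule sum_count_set[symmetric]) auto
  also have "\<dots> = (\<Sum>y | y \<in> set r \<and> P y. count_list r y)"
    by (intro sum.cong) (auto simp: count_list_filter)
  finally show ?thesis .
qed

text \<open>
  Only the multiset of entries enters the ranking condition. The range condition on the entries is
  a consequence: an entry is not less than itself, so fewer than \<open>n\<close> entries are below it.
\<close>

lemma fubini_ranking_iff:
  "fubini_ranking n r \<longleftrightarrow> length r = n \<and>
     (\<forall>v\<in>set r. v = 1 + (\<Sum>y | y \<in> set r \<and> y < v. count_list r y))"
proof -
  have "set r \<subseteq> {1..length r}" if "\<forall>v\<in>set r. v = 1 + length (filter (\<lambda>y. y < v) r)"
  proof
    fix v assume v: "v \<in> set r"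
    then have "length (filter (\<lambda>y. y < v) r) < length r" by (intro length_filter_less) auto
    moreover have "v = 1 + length (filter (\<lambda>y. y < v) r)" using that v by blast
    ultimately show "v \<in> {1..length r}" by (metis Suc_eq_plus1_left Suc_leI atLeastAtMost_iff le_add1)
  qed
  moreover have "card {j. j < length r \<and> r ! j < v} = length (filter (\<lambda>y. y < v) r)" for v
    by (simp add: length_filter_conv_card)
  ultimately show ?thesis
    unfolding fubini_ranking_def length_filter_eq_sum_count[symmetric]
    by (auto simp: all_set_conv_all_nth)
qed

lemma reduced_content_eq:
  assumes "set r \<subseteq> {1..length r}"
  shows "reduced_content r = map (count_list r) (sorted_list_of_set (set r))"
proof -
  have "filter (\<lambda>v. count_list r v \<noteq> 0) [1..<length r + 1] = sorted_list_of_set (set r)"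
    using assms
    by (intro sorted_distinct_set_unique)
      (auto simp: count_list_0_iff sorted_wrt_filter simp del: upt_Suc)
  then show ?thesis by (simp add: reduced_content_def content_def filter_map o_def)
qed

text \<open>
  The rank shared by the competitors of block \<open>i\<close> when the blocks have sizes \<open>a 1, a 2, \<dots>\<close>.
\<close>

definition block_rank :: "(nat \<Rightarrow> nat) \<Rightarrow> nat \<Rightarrow> nat" where
  "block_rank a i = 1 + (\<Sum>l=1..<i. a l)"

lemma strict_mono_on_block_rank:
  assumes "\<forall>i\<in>{1..k}. a i > 0"
  shows "strict_mono_on {1..k} (block_rank a)"
proof (rule strict_mono_onI)
  fix i l assume il: "i \<in> {1..k}" "l \<in> {1..k}" "i < l"
  have "(\<Sum>l=1..<i. a l) < (\<Sum>l=1..<l. a l)"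
    using il assms by (intro sum_strict_mono2[of _ _ i]) auto
  then show "block_rank a i < block_rank a l" by (simp add: block_rank_def)
qed

text \<open>
  In one direction, the reduced content lists the multiplicities of the distinct ranks in increasing
  order, and the ranking condition at the \<open>i\<close>-th smallest rank then computes this rank from the
  multiplicities of the smaller ones. Conversely, the multiset determines both properties.
\<close>

lemma fubini_ranking_with_reduced_content_iff:
  assumes pos: "\<forall>i\<in>{1..k}. a i > 0" and n: "(\<Sum>i=1..k. a i) = n"
  shows "fubini_ranking n r \<and> reduced_content r = map a [1..<k + 1] \<longleftrightarrow>
    mset r = letters a (block_rank a) k"
proof -
  let ?b = "block_rank a"
  note mono = strict_mono_on_block_rank[OF pos]
  have inj: "inj_on ?b {1..k}" using mono by (rule strict_mono_on_imp_inj_on)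
  show ?thesis
  proof
    assume h: "fubini_ranking n r \<and> reduced_content r = map a [1..<k + 1]"
    define xs where "xs = sorted_list_of_set (set r)"
    have set_xs: "set xs = set r" and sorted_xs: "sorted_wrt (<) xs"
      by (simp_all add: xs_def)
    have "set r \<subseteq> {1..length r}" using h by (simp add: fubini_ranking_def)
    then have cnt: "map (count_list r) xs = map a [1..<k + 1]"
      using h reduced_content_eq by (simp add: xs_def)
    then have len: "length xs = k" by (metis add_diff_cancel_right' length_map length_upt)
    have cnt_nth: "count_list r (xs ! i) = a (Suc i)" if "i < k" for i
      using arg_cong[OF cnt, of "\<lambda>ys. ys ! i"] that len by (simp del: upt_Suc)
    have inj_nth: "inj_on ((!) xs) {..<k}"
      using len by (intro inj_on_nth) (auto simp: xs_def)
    have xs_nth: "xs ! i = ?b (Suc i)" if i: "i < k" for i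
    proof -
      have below: "{y. y \<in> set r \<and> y < xs ! i} = (!) xs ` {..<i}"
      proof (intro equalityI subsetI)
        fix y assume "y \<in> {y. y \<in> set r \<and> y < xs ! i}"
        then have "y \<in> set xs" "y < xs ! i" using set_xs by auto
        then obtain l where l: "l < k" "y = xs ! l" "xs ! l < xs ! i"
          using len by (metis in_set_conv_nth)
        then have "l < i"
          using sorted_wrt_nth_less[OF sorted_xs, of i l] len
          by (metis linorder_neqE_nat order_less_asym order_less_irrefl)
        then show "y \<in> (!) xs ` {..<i}" using l by blast
      next
        fix y assume "y \<in> (!) xs ` {..<i}"
        then show "y \<in> {y. y \<in> set r \<and> y < xs ! i}"
          using sorted_wrt_nth_less[OF sorted_xs, of _ i] len i by (auto simp flip: set_xs)
      qed
      have "xs ! i \<in> set r" using i len set_xs by (metis nth_mem)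
      then have "xs ! i = 1 + (\<Sum>y | y \<in> set r \<and> y < xs ! i. count_list r y)"
        using h unfolding fubini_ranking_iff by blast
      also have "\<dots> = 1 + (\<Sum>l<i. count_list r (xs ! l))"
        unfolding below using i by (subst sum.reindex) (auto intro: inj_on_subset[OF inj_nth])
      also have "\<dots> = 1 + (\<Sum>l<i. a (Suc l))" using i cnt_nth by simp
      also have "(\<Sum>l<i. a (Suc l)) = (\<Sum>l=1..<Suc i. a l)"
        by (simp only: One_nat_def sum.shift_bounds_Suc_ivl lessThan_atLeast0)
      finally show ?thesis by (simp add: block_rank_def)
    qed
    have "set r = ?b ` {1..k}"
    proof -
      have "set xs = (\<lambda>i. ?b (Suc i)) ` {..<k}"
        using xs_nth len by (force simp: set_conv_nth)
      also have "\<dots> = ?b ` {1..k}"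
        by (simp add: image_image[symmetric] image_Suc_lessThan)
      finally show ?thesis using set_xs by simp
    qed
    moreover have "count_list r (?b l) = a l" if "l \<in> {1..k}" for l
      using xs_nth[of "l - 1"] cnt_nth[of "l - 1"] that by auto
    ultimately have set_r: "set r = ?b ` {1..k}"
      and cnt_b: "\<And>l. l \<in> {1..k} \<Longrightarrow> count_list r (?b l) = a l" by blast+
    show "mset r = letters a ?b k"
    proof (rule multiset_eqI)
      fix x
      show "count (mset r) x = count (letters a ?b k) x"
      proof (cases "x \<in> set r")
        case True
        then show ?thesis using set_r cnt_b count_letters[OF inj, of _ a] by (auto simp: count_mset)
      next
        case False
        then have "x \<notin># letters a ?b k" using set_letters_subset[of a ?b k] set_r by blast
        then show ?thesis using False by (simp add: count_mset not_in_iff)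
      qed
    qed
  next
    assume m: "mset r = letters a ?b k"
    have len: "length r = n"
      using arg_cong[OF m, of size] n by (simp add: letters_def)
    have cnt: "count_list r (?b l) = a l" if "l \<in> {1..k}" for l
      using count_letters[OF inj that, of a] m by (simp flip: count_mset)
    have set_r: "set r = ?b ` {1..k}"
    proof
      show "set r \<subseteq> ?b ` {1..k}" using set_letters_subset[of a ?b k] m by (metis set_mset_mset)
      show "?b ` {1..k} \<subseteq> set r"
      proof (rule image_subsetI)
        fix l assume "l \<in> {1..k}"
        then have "count_list r (?b l) \<noteq> 0" using cnt pos by (metis not_gr0)
        then show "?b l \<in> set r" by (simp add: count_list_0_iff)
      qed
    qed
    have "?b l = 1 + (\<Sum>y | y \<in> set r \<and> y < ?b l. count_list r y)" if l: "l \<in> {1..k}" for l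
    proof -
      have "{y. y \<in> set r \<and> y < ?b l} = ?b ` {1..<l}"
        using l strict_mono_on_less[OF mono] by (auto simp: set_r)
      then have "(\<Sum>y | y \<in> set r \<and> y < ?b l. count_list r y) = (\<Sum>i=1..<l. count_list r (?b i))"
        using l by (simp only:, subst sum.reindex) (auto intro: inj_on_subset[OF inj])
      also have "\<dots> = (\<Sum>i=1..<l. a i)" using l cnt by (intro sum.cong) auto
      finally show ?thesis by (simp add: block_rank_def)
    qed
    then have fub: "fubini_ranking n r"
      using len by (auto simp: fubini_ranking_iff set_r)
    have "sorted_wrt (\<lambda>i l. ?b i \<le> ?b l) [1..<k + 1]"
      using strict_mono_on_leD[OF mono]
      by (intro sorted_wrt_mono_rel[OF _ sorted_wrt_upt[of 1 "k + 1"]]) auto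
    then have "sorted_list_of_set (set r) = map ?b [1..<k + 1]"
      using inj by (intro sorted_distinct_set_unique)
        (auto simp: set_r distinct_map sorted_wrt_map atLeastLessThanSuc_atLeastAtMost
          simp del: upt_Suc)
    moreover have "set r \<subseteq> {1..length r}" using fub by (simp add: fubini_ranking_def)
    ultimately show "fubini_ranking n r \<and> reduced_content r = map a [1..<k + 1]"
      using fub cnt by (simp add: reduced_content_eq del: upt_Suc)
  qed
qed

theorem theorem5p1:
  fixes n k :: nat and a :: "nat \<Rightarrow> nat"
  assumes "k \<ge> 1"
    and "\<forall>i\<in>{1..k}. a i > 0"
    and "(\<Sum>i=1..k. a i) = n"
    and "\<exists>r. fubini_ranking n r \<and> reduced_content r = map a [1..<k + 1]"
  shows "card {r. fubini_ranking n r \<and> weakly_flattened r \<and>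
                  reduced_content r = map a [1..<k + 1]} =
    (\<Sum>j \<in> (\<Pi>\<^sub>E i\<in>{2..k}. {0..a i}).
       \<Prod>i=2..k. ((a 1 + (\<Sum>r=2..i - 1. j r) - 1) choose (a i - j i)))"
proof -
  have "{r. fubini_ranking n r \<and> weakly_flattened r \<and> reduced_content r = map a [1..<k + 1]} =
      {r. mset r = letters a (block_rank a) k \<and> flat r}"
    using fubini_ranking_with_reduced_content_iff[OF assms(2,3)] weakly_flattened_iff_flat by blast
  then show ?thesis
    using card_flat_words_with_letters[OF assms(1) strict_mono_on_block_rank[OF assms(2)]] assms(1,2)
    by simp
qed

end
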